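(* Let $k\ge 0$, let $\tau_k>0$, and let $\mu^k=\mu^{\pi^k}\in\mathcal M_{\mu_0}^*$ be the current iterate, induced by a policy $\pi^k$ with $\pi^k_n(a|x)\neq 0$ for all $n\in[N]$, $(x,a)\in\mathcal X\times\mathcal A$. Consider the problem $$\mu^{k+1}\in\operatorname*{arg\,min}_{\mu^\pi\in\mathcal M_{\mu_0}}\Big\{\langle\nabla F(\mu^k),\mu^\pi\rangle+\frac1{\tau_k}\Gamma(\mu^\pi,\mu^k)\Big\}.$$ The solution of this problem is $\mu^{k+1}=\mu^{\pi^{k+1}}$, where for all $n\in[N]$ and $(x,a)\in\mathcal X\times\mathcal A$, $$\pi_n^{k+1}(a|x):=\frac{\pi_n^k(a|x)\exp\big(\tau_k\tilde Q_n^k(x,a)\big)}{\sum_{a'\in\mathcal A}\pi_n^k(a'|x)\exp\big(\tau_k\tilde Q_n^k(x,a')\big)},$$ and where $\tilde Q^k$ satisfies the backward recursion $\tilde Q_N^k(x,a)=-\nabla f_N(\mu_N^k)(x,a)$ and, for $n<N$, $$\tilde Q_n^k(x,a)=\max_{\pi_{n+1}\in(\Delta_{\mathcal A})^{\mathcal X}}\Big\{-\nabla f_n(\mu_n^k)(x,a)+\sum_{x'}p_{n+1}(x'|x,a)\sum_{a'}\pi_{n+1}(a'|x')\Big[-\frac1{\tau_k}\log\Big(\frac{\pi_{n+1}(a'|x')}{\pi^k_{n+1}(a'|x')}\Big)+\tilde Q^k_{n+1}(x',a')\Big]\Big\}.$$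
   Context: Notation: $[s]=\{1,\dots,s\}$; $\Delta_S$ is the probability simplex over a finite set $S$; $0\log 0=0$. $\mathcal X$ (states) and $\mathcal A$ (actions) are finite sets, $N\ge1$ is the episode length, $p=(p_n)_{n\in[N]}$ is a transition kernel, $p_n(x'|x,a)$ being the probability of being in state $x'$ at step $n$ given state-action pair $(x,a)$ at step $n-1$. $\mu_0\in\Delta_{\mathcal X\times\mathcal A}$ is a fixed initial state-action distribution. A policy is $\pi=(\pi_n)_{n\in[N]}\in(\Delta_{\mathcal A})^{\mathcal X\times N}$, with $\pi_n(\cdot|x)\in\Delta_{\mathcal A}$. The induced state-action distribution sequence $\mu^\pi=\mu^{\pi,p}$ is given by $\mu_0^{\pi}=\mu_0$ and $\mu_n^{\pi}(x',a')=\sum_{x,a}\mu_{n-1}^{\pi}(x,a)p_n(x'|x,a)\pi_n(a'|x')$ for $n\in[N]$. $\mathcal M_{\mu_0}$ is the set of $\mu=(\mu_n)_{n\in[N]}\in(\Delta_{\mathcal X\times\mathcal A})^N$ such that $\sum_{a'}\mu_n(x',a')=\sum_{x,a}p_n(x'|x,a)\mu_{n-1}(x,a)$ for all $x'\in\mathcal X$, $n\in[N]$ (with $\mu_0$ the fixed initial distribution). Every $\mu\in\mathcal M_{\mu_0}$ is $\mu^\pi$ for the policy $\pi_n(a|x)=\mu_n(x,a)/\sum_{a'}\mu_n(x,a')$ when the denominator is nonzero and $\pi_n(a|x)=1/|\mathcal A|$ otherwise. $\mathcal M_{\mu_0}^*$ is the subset of $\mathcal M_{\mu_0}$ whose corresponding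 policies satisfy $\pi_n(a|x)\ne0$ for all $n,x,a$. For $\mu^\pi\in\mathcal M_{\mu_0}$, $\mu^{\pi'}\in\mathcal M^*_{\mu_0}$, $$\Gamma(\mu^\pi,\mu^{\pi'}):=\sum_{n=1}^N\sum_{x,a}\mu_n^\pi(x,a)\log\Big(\frac{\pi_n(a|x)}{\pi'_n(a|x)}\Big).$$ $F(\mu)=\sum_{n=1}^Nf_n(\mu_n)$, where each $f_n:\Delta_{\mathcal X\times\mathcal A}\to\mathbb R$ is convex, $\ell$-Lipschitz with respect to $\|\cdot\|_1$, and differentiable with gradient $\nabla f_n(\mu_n)\in\mathbb R^{\mathcal X\times\mathcal A}$; $\langle\nabla F(\mu^k),\mu^\pi\rangle:=\sum_{n=1}^N\langle\nabla f_n(\mu_n^k),\mu_n^\pi\rangle$. *)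

theory Defs
  imports "HOL-Analysis.Analysis"
begin

definition prob_simplex :: "(real ^ 'i::finite) set" where
  "prob_simplex = {v. (\<forall>i. 0 \<le> v $ i) \<and> (\<Sum>i\<in>UNIV. v $ i) = 1}"

definition norm_l1 :: "real ^ 'i::finite \<Rightarrow> real" where
  "norm_l1 v = (\<Sum>i\<in>UNIV. \<bar>v $ i\<bar>)"

text \<open>
  The finite sets of states and actions are the types \<open>'x\<close> and \<open>'a\<close>. We write
  \<open>p n (x, a) $ x'\<close> for $p_n(x' | x, a)$ and \<open>\<pi> n x $ a\<close> for $\pi_n(a | x)$; only
  the steps \<open>n \<in> {1..N}\<close> are meaningful.
\<close>

type_synonym ('x, 'a) kernel = "nat \<Rightarrow> 'x \<times> 'a \<Rightarrow> real ^ 'x"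
type_synonym ('x, 'a) policy = "nat \<Rightarrow> 'x \<Rightarrow> real ^ 'a"
type_synonym ('x, 'a) dist_seq = "nat \<Rightarrow> real ^ ('x \<times> 'a)"

definition kernels :: "nat \<Rightarrow> ('x::finite, 'a::finite) kernel set" where
  "kernels N = {p. \<forall>n\<in>{1..N}. \<forall>xa. p n xa \<in> prob_simplex}"

definition policies :: "nat \<Rightarrow> ('x::finite, 'a::finite) policy set" where
  "policies N = {\<pi>. \<forall>n\<in>{1..N}. \<forall>x. \<pi> n x \<in> prob_simplex}"

primrec state_action_dist ::
  "real ^ ('x \<times> 'a) \<Rightarrow> ('x::finite, 'a::finite) kernel \<Rightarrow> ('x, 'a) policy \<Rightarrow> ('x, 'a) dist_seq"
where
  "state_action_dist \<mu>0 p \<pi> 0 = \<mu>0"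
| "state_action_dist \<mu>0 p \<pi> (Suc n) =
    (\<chi> i. \<Sum>x\<in>UNIV. \<Sum>a\<in>UNIV.
        state_action_dist \<mu>0 p \<pi> n $ (x, a) * p (Suc n) (x, a) $ fst i * \<pi> (Suc n) (fst i) $ snd i)"

text \<open>
  Elements of $(\Delta_{X \times A})^N$ are functions on \<open>{1..N}\<close>, extended by
  \<open>undefined\<close> elsewhere so that equality of sequences is equality at the steps
  \<open>1, \<dots>, N\<close>. The initial distribution is not part of the sequence.
\<close>

definition induced_seq ::
  "nat \<Rightarrow> real ^ ('x \<times> 'a) \<Rightarrow> ('x::finite, 'a::finite) kernel \<Rightarrow> ('x, 'a) policy \<Rightarrow> ('x, 'a) dist_seq"
where
  "induced_seq N \<mu>0 p \<pi> = restrict (state_action_dist \<mu>0 p \<pi>) {1..N}"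

definition feasible_seqs ::
  "nat \<Rightarrow> real ^ ('x \<times> 'a) \<Rightarrow> ('x::finite, 'a::finite) kernel \<Rightarrow> ('x, 'a) dist_seq set"
where
  "feasible_seqs N \<mu>0 p = {\<mu> \<in> {1..N} \<rightarrow>\<^sub>E prob_simplex.
     \<forall>n\<in>{1..N}. \<forall>x'.
       (\<Sum>a'\<in>UNIV. \<mu> n $ (x', a')) =
       (\<Sum>x\<in>UNIV. \<Sum>a\<in>UNIV. p n (x, a) $ x' * (\<mu>(0 := \<mu>0)) (n - 1) $ (x, a))}"

definition policy_of :: "('x::finite, 'a::finite) dist_seq \<Rightarrow> ('x, 'a) policy" where
  "policy_of \<mu> n x =
    (\<chi> a. if (\<Sum>a'\<in>UNIV. \<mu> n $ (x, a')) \<noteq> 0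
          then \<mu> n $ (x, a) / (\<Sum>a'\<in>UNIV. \<mu> n $ (x, a'))
          else 1 / real CARD('a))"

definition feasible_seqs_pos ::
  "nat \<Rightarrow> real ^ ('x \<times> 'a) \<Rightarrow> ('x::finite, 'a::finite) kernel \<Rightarrow> ('x, 'a) dist_seq set"
where
  "feasible_seqs_pos N \<mu>0 p =
    {\<mu> \<in> feasible_seqs N \<mu>0 p. \<forall>n\<in>{1..N}. \<forall>x a. policy_of \<mu> n x $ a \<noteq> 0}"

text \<open>
  In the next two definitions \<open>ln\<close> is applied to \<open>0\<close> only when multiplied by \<open>0\<close>,
  which realizes the convention $0 \log 0 = 0$.
\<close>

definition Gamma_div :: "nat \<Rightarrow> ('x::finite, 'a::finite) dist_seq \<Rightarrow> ('x, 'a) dist_seq \<Rightarrow> real" where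
  "Gamma_div N \<mu> \<nu> =
    (\<Sum>n = 1..N. \<Sum>x\<in>UNIV. \<Sum>a\<in>UNIV.
        \<mu> n $ (x, a) * ln (policy_of \<mu> n x $ a / policy_of \<nu> n x $ a))"

text \<open>
  \<open>g n \<nu>\<close> stands for $\nabla f_n(\nu)$. The expression maximized over
  $\sigma = \pi_{n+1}$ in the recursion for $\tilde Q_n(x, a)$:
\<close>

definition regularized_backup ::
  "('x::finite, 'a::finite) kernel \<Rightarrow> (nat \<Rightarrow> real ^ ('x \<times> 'a) \<Rightarrow> real ^ ('x \<times> 'a)) \<Rightarrow> real \<Rightarrow>
   ('x, 'a) policy \<Rightarrow> ('x, 'a) dist_seq \<Rightarrow> (nat \<Rightarrow> 'x \<Rightarrow> 'a \<Rightarrow> real) \<Rightarrow>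
   nat \<Rightarrow> 'x \<Rightarrow> 'a \<Rightarrow> ('x \<Rightarrow> real ^ 'a) \<Rightarrow> real"
where
  "regularized_backup p g \<tau> \<pi>k \<mu>k Q n x a \<sigma> =
    - (g n (\<mu>k n) $ (x, a)) +
    (\<Sum>x'\<in>UNIV. p (n + 1) (x, a) $ x' *
      (\<Sum>a'\<in>UNIV. \<sigma> x' $ a' *
        (- (1 / \<tau>) * ln (\<sigma> x' $ a' / \<pi>k (n + 1) x' $ a') + Q (n + 1) x' a')))"

definition regularized_Q ::
  "nat \<Rightarrow> ('x::finite, 'a::finite) kernel \<Rightarrow> (nat \<Rightarrow> real ^ ('x \<times> 'a) \<Rightarrow> real ^ ('x \<times> 'a)) \<Rightarrow> real \<Rightarrow>
   ('x, 'a) policy \<Rightarrow> ('x, 'a) dist_seq \<Rightarrow> (nat \<Rightarrow> 'x \<Rightarrow> 'a \<Rightarrow> real) \<Rightarrow> bool"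
where
  "regularized_Q N p g \<tau> \<pi>k \<mu>k Q \<longleftrightarrow>
    (\<forall>x a. Q N x a = - (g N (\<mu>k N) $ (x, a))) \<and>
    (\<forall>n\<in>{1..<N}. \<forall>x a. \<exists>\<sigma>.
        is_arg_max (regularized_backup p g \<tau> \<pi>k \<mu>k Q n x a)
          (\<lambda>\<sigma>. \<forall>x'. \<sigma> x' \<in> prob_simplex) \<sigma> \<and>
        Q n x a = regularized_backup p g \<tau> \<pi>k \<mu>k Q n x a \<sigma>)"

definition softmax_policy ::
  "real \<Rightarrow> ('x::finite, 'a::finite) policy \<Rightarrow> (nat \<Rightarrow> 'x \<Rightarrow> 'a \<Rightarrow> real) \<Rightarrow> ('x, 'a) policy"
where
  "softmax_policy \<tau> \<pi>k Q n x =
    (\<chi> a. \<pi>k n x $ a * exp (\<tau> * Q n x a) /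
          (\<Sum>a'\<in>UNIV. \<pi>k n x $ a' * exp (\<tau> * Q n x a')))"

definition step_objective ::
  "nat \<Rightarrow> (nat \<Rightarrow> real ^ ('x \<times> 'a) \<Rightarrow> real ^ ('x \<times> 'a)) \<Rightarrow> real \<Rightarrow>
   ('x::finite, 'a::finite) dist_seq \<Rightarrow> ('x, 'a) dist_seq \<Rightarrow> real"
where
  "step_objective N g \<tau> \<mu>k \<mu> =
    (\<Sum>n = 1..N. g n (\<mu>k n) \<bullet> \<mu> n) + 1 / \<tau> * Gamma_div N \<mu> \<mu>k"

end

theory Submission
  imports Defs
begin

text \<open>
  Write $Z_n(x) = \sum_a \pi^k_n(a|x) \exp(\tau \tilde Q_n(x,a))$ and
  $V_n = \tau^{-1} \log Z_n$. By the Gibbs variational principle the maximum in the recursion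
  for $\tilde Q_n$ is attained at the softmax policy $\pi^*$ and equals
  $-\nabla f_n + \sum_{x'} p_{n+1}(x'|\cdot) V_{n+1}(x')$. Solving this for $\nabla f_n$ makes
  the objective of a feasible $\mu = \mu^\pi$ with state marginals $\rho_n$ telescope to
  $$-\sum_x \rho_1(x) V_1(x)
    + \frac{1}{\tau} \sum_{n,x} \rho_n(x)\, KL(\pi_n(\cdot|x) \,\|\, \pi^*_n(\cdot|x)),$$
  where $\rho_1$ depends only on $\mu_0$. By Gibbs' inequality this is minimal exactly when
  $\pi_n(\cdot|x) = \pi^*_n(\cdot|x)$ wherever $\rho_n(x) > 0$, that is, when $\mu = \mu^{\pi^*}$.
\<close>

section \<open>Relative entropy and the Gibbs variational principle\<close>

definition rel_entropy :: "real ^ 'i::finite \<Rightarrow> real ^ 'i \<Rightarrow> real" where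
  "rel_entropy s t = (\<Sum>i\<in>UNIV. s $ i * ln (s $ i / t $ i))"

text \<open>For positive \<open>w\<close> and \<open>\<tau>\<close>, this is the log-partition
  function scaled by \<open>1 / \<tau>\<close>: the maximum over probability vectors of the mean of
  \<open>q\<close> minus \<open>1 / \<tau>\<close> times the relative entropy to
  \<open>w\<close>.\<close>

definition soft_value :: "real \<Rightarrow> real ^ 'i::finite \<Rightarrow> ('i \<Rightarrow> real) \<Rightarrow> real" where
  "soft_value \<tau> w q = 1 / \<tau> * ln (\<Sum>i\<in>UNIV. w $ i * exp (\<tau> * q i))"

definition softmax :: "real \<Rightarrow> real ^ 'i::finite \<Rightarrow> ('i \<Rightarrow> real) \<Rightarrow> real ^ 'i" where
  "softmax \<tau> w q = (\<chi> i. w $ i * exp (\<tau> * q i) / (\<Sum>j\<in>UNIV. w $ j * exp (\<tau> * q j)))"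

lemma softmax_policy_eq: "softmax_policy \<tau> \<pi> Q n x = softmax \<tau> (\<pi> n x) (Q n x)"
  by (simp add: softmax_policy_def softmax_def)

text \<open>Multiplying \<open>ln y \<le> y - 1\<close> at \<open>y = t / s\<close> by
  \<open>s\<close> gives the bound; strictness away from \<open>y = 1\<close> gives the equality
  case. At \<open>s = 0\<close> the product vanishes.\<close>

lemma ln_diff_bound:
  fixes s t :: real
  assumes "0 \<le> s" "0 < t"
  shows "s - t \<le> s * ln (s / t)" and "s * ln (s / t) = s - t \<longleftrightarrow> s = t"
proof -
  have "s - t \<le> s * ln (s / t) \<and> (s * ln (s / t) = s - t \<longleftrightarrow> s = t)"
  proof (cases "s = 0")
    case True
    then show ?thesis using assms by auto
  next
    case False
    with assms have s: "s > 0" by simp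
    have inv: "ln (s / t) = - ln (t / s)"
      using s assms by (simp add: ln_div)
    have le: "ln (t / s) \<le> t / s - 1"
      using s assms by (intro ln_le_minus_one) simp
    have "s * ln (t / s) \<le> s * (t / s - 1)"
      using le s by (intro mult_left_mono) auto
    then have 1: "s - t \<le> s * ln (s / t)"
      using s inv by (simp add: algebra_simps)
    have "s = t" if "s * ln (s / t) = s - t"
    proof -
      have "s * ln (t / s) = s * (t / s - 1)"
        using that s inv by (simp add: algebra_simps)
      then have "ln (t / s) = t / s - 1" using s by simp
      then have "t / s = 1" using s assms by (intro ln_eq_minus_one) auto
      then show ?thesis using s by simp
    qed
    then show ?thesis using 1 s by auto
  qed
  then show "s - t \<le> s * ln (s / t)" and "s * ln (s / t) = s - t \<longleftrightarrow> s = t" by blast+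
qed

text \<open>Both vectors have mass one, so subtracting \<open>s $ i - t $ i\<close> from each
  summand leaves the sum unchanged and makes every summand nonnegative, with value zero only where
  the entries agree.\<close>

lemma gibbs_inequality:
  assumes s: "s \<in> prob_simplex" and t: "t \<in> prob_simplex" and pos: "\<And>i. 0 < t $ i"
  shows rel_entropy_nonneg: "0 \<le> rel_entropy s t"
    and rel_entropy_eq_0_iff: "rel_entropy s t = 0 \<longleftrightarrow> s = t"
proof -
  have nn: "0 \<le> s $ i" for i using s by (simp add: prob_simplex_def)
  let ?h = "\<lambda>i. s $ i * ln (s $ i / t $ i) - (s $ i - t $ i)"
  have h: "0 \<le> ?h i" "?h i = 0 \<longleftrightarrow> s $ i = t $ i" for i
    using ln_diff_bound[OF nn pos, of i i] by auto
  have eq: "rel_entropy s t = (\<Sum>i\<in>UNIV. ?h i)"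
    using s t by (simp add: rel_entropy_def prob_simplex_def sum_subtractf)
  show "0 \<le> rel_entropy s t"
    unfolding eq by (intro sum_nonneg h)
  show "rel_entropy s t = 0 \<longleftrightarrow> s = t"
    unfolding eq by (subst sum_nonneg_eq_0_iff) (use h in \<open>auto simp: vec_eq_iff\<close>)
qed

section \<open>Softmax distributions over a positive prior\<close>

lemma softmax_partition_pos:
  fixes w :: "real ^ 'i::finite"
  assumes "\<And>i. 0 < w $ i"
  shows "0 < (\<Sum>i\<in>UNIV. w $ i * exp (\<tau> * q i))"
  using assms by (intro sum_pos) auto

lemma softmax_pos:
  assumes "\<And>i. 0 < w $ i"
  shows "0 < softmax \<tau> w q $ i"
  using assms softmax_partition_pos[of w \<tau> q] by (simp add: softmax_def)

lemma softmax_in_prob_simplex: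
  assumes "\<And>i. 0 < w $ i"
  shows "softmax \<tau> w q \<in> prob_simplex"
  using softmax_partition_pos[of w \<tau> q, OF assms] softmax_pos[of w \<tau> q, OF assms]
  by (auto simp: prob_simplex_def softmax_def less_imp_le simp flip: sum_divide_distrib)

lemma ln_softmax:
  assumes "\<And>i. 0 < w $ i" "\<tau> > 0"
  shows "ln (softmax \<tau> w q $ i) = ln (w $ i) + \<tau> * (q i - soft_value \<tau> w q)"
  using assms(2) assms(1)[of i] softmax_partition_pos[of w \<tau> q, OF assms(1)]
  by (simp add: softmax_def soft_value_def ln_div ln_mult algebra_simps)

text \<open>Changing the reference from \<open>w\<close> to \<open>softmax\<close> costs
  \<open>q i\<close> minus the soft value. Without the factor \<open>s\<close> the identity can fail
  at \<open>s = 0\<close>; the factor \<open>m\<close> makes room for a state marginal.\<close>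

lemma entropy_term_softmax:
  assumes "\<And>i. 0 < w $ i" "\<tau> > 0" "0 \<le> s"
  shows "m * s * (1 / \<tau> * ln (s / w $ i)) =
    m * s * (1 / \<tau> * ln (s / softmax \<tau> w q $ i) + q i - soft_value \<tau> w q)"
proof (cases "s = 0")
  case False
  then have "ln (s / w $ i) = ln (s / softmax \<tau> w q $ i) + \<tau> * (q i - soft_value \<tau> w q)"
    using assms(2,3) assms(1)[of i] softmax_pos[of w \<tau> q i, OF assms(1)] ln_softmax[of w \<tau> q i, OF assms(1,2)]
    by (simp add: ln_div)
  then have "1 / \<tau> * ln (s / w $ i) = 1 / \<tau> * ln (s / softmax \<tau> w q $ i) + q i - soft_value \<tau> w q"
    using assms(2) by (simp add: field_simps)
  then show ?thesis by simp
qed simp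

text \<open>After the change of reference \<open>q\<close> cancels, and since \<open>s\<close> has
  mass one only the soft value and a relative entropy remain. Maximum and maximizer can then be read
  off from Gibbs' inequality.\<close>

lemma gibbs_variational:
  assumes w: "\<And>i. 0 < w $ i" and \<tau>: "\<tau> > 0" and s: "s \<in> prob_simplex"
  shows "(\<Sum>i\<in>UNIV. s $ i * (- (1 / \<tau>) * ln (s $ i / w $ i) + q i)) =
    soft_value \<tau> w q - 1 / \<tau> * rel_entropy s (softmax \<tau> w q)"
proof -
  have "s $ i * (- (1 / \<tau>) * ln (s $ i / w $ i) + q i) =
      s $ i * soft_value \<tau> w q - 1 / \<tau> * (s $ i * ln (s $ i / softmax \<tau> w q $ i))" for i
    using entropy_term_softmax[of w \<tau> "s $ i" 1 i q, OF w \<tau>] s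
    by (simp add: prob_simplex_def algebra_simps)
  then show ?thesis
    using s
    by (simp add: rel_entropy_def sum_subtractf prob_simplex_def
        flip: sum_distrib_left sum_distrib_right sum_divide_distrib)
qed

section \<open>The regularized Bellman recursion\<close>

text \<open>Closed form of the maximum in the recursion, with the gradients at the current iterate
  frozen in \<open>c\<close>.\<close>

definition soft_backup ::
  "('x::finite, 'a::finite) kernel \<Rightarrow> (nat \<Rightarrow> real ^ ('x \<times> 'a)) \<Rightarrow> real \<Rightarrow>
   ('x, 'a) policy \<Rightarrow> nat \<Rightarrow> ('x \<Rightarrow> 'a \<Rightarrow> real) \<Rightarrow> 'x \<Rightarrow> 'a \<Rightarrow> real"
where
  "soft_backup p c \<tau> \<pi> n q x a =
    - (c n $ (x, a)) + (\<Sum>x'\<in>UNIV. p (n + 1) (x, a) $ x' * soft_value \<tau> (\<pi> (n + 1) x') (q x'))"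

text \<open>Indexed by the number of steps remaining until the horizon.\<close>

primrec soft_Q_back ::
  "nat \<Rightarrow> ('x::finite, 'a::finite) kernel \<Rightarrow> (nat \<Rightarrow> real ^ ('x \<times> 'a)) \<Rightarrow> real \<Rightarrow>
   ('x, 'a) policy \<Rightarrow> nat \<Rightarrow> 'x \<Rightarrow> 'a \<Rightarrow> real"
where
  "soft_Q_back N p c \<tau> \<pi> 0 = (\<lambda>x a. - (c N $ (x, a)))"
| "soft_Q_back N p c \<tau> \<pi> (Suc m) = soft_backup p c \<tau> \<pi> (N - Suc m) (soft_Q_back N p c \<tau> \<pi> m)"

text \<open>The maximization splits over next states: the loss of \<open>\<sigma>\<close> against
  the softmax policy is a transition-weighted sum of relative entropies. A single policy therefore
  serves all pairs \<open>(x, a)\<close> at once.\<close>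

lemma regularized_backup_softmax:
  assumes p: "\<And>x'. 0 \<le> p (n + 1) (x, a) $ x'"
    and w: "\<And>x' a'. 0 < \<pi> (n + 1) x' $ a'" and \<tau>: "\<tau> > 0"
  shows "is_arg_max (regularized_backup p g \<tau> \<pi> \<mu> Q n x a) (\<lambda>\<sigma>. \<forall>x'. \<sigma> x' \<in> prob_simplex)
           (softmax_policy \<tau> \<pi> Q (n + 1))"
    and "regularized_backup p g \<tau> \<pi> \<mu> Q n x a (softmax_policy \<tau> \<pi> Q (n + 1)) =
           soft_backup p (\<lambda>n. g n (\<mu> n)) \<tau> \<pi> n (Q (n + 1)) x a"
proof -
  let ?R = "regularized_backup p g \<tau> \<pi> \<mu> Q n x a"
  let ?B = "soft_backup p (\<lambda>n. g n (\<mu> n)) \<tau> \<pi> n (Q (n + 1)) x a"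
  let ?S = "softmax_policy \<tau> \<pi> Q (n + 1)"
  let ?D = "\<lambda>\<sigma>. \<Sum>x'\<in>UNIV. p (n + 1) (x, a) $ x' * (1 / \<tau> * rel_entropy (\<sigma> x') (?S x'))"
  have S: "?S x' \<in> prob_simplex" "0 < ?S x' $ a'" for x' a'
    using w by (auto simp: softmax_policy_eq intro!: softmax_in_prob_simplex softmax_pos)
  have R: "?R \<sigma> = ?B - ?D \<sigma>" if "\<forall>x'. \<sigma> x' \<in> prob_simplex" for \<sigma>
    using that w \<tau> unfolding regularized_backup_def soft_backup_def
    by (subst gibbs_variational)
      (auto simp: softmax_policy_eq right_diff_distrib sum_subtractf)
  have D: "0 \<le> ?D \<sigma>" if "\<forall>x'. \<sigma> x' \<in> prob_simplex" for \<sigma>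
    using that p \<tau> S by (intro sum_nonneg mult_nonneg_nonneg rel_entropy_nonneg) auto
  have "rel_entropy (?S x') (?S x') = 0" for x'
    using rel_entropy_eq_0_iff[OF S(1)[of x'] S(1)[of x'] S(2)] by blast
  then show eq: "?R ?S = ?B"
    using S by (subst R) auto
  show "is_arg_max ?R (\<lambda>\<sigma>. \<forall>x'. \<sigma> x' \<in> prob_simplex) ?S"
    unfolding is_arg_max_def eq
  proof (intro conjI notI)
    assume "\<exists>\<sigma>. (\<forall>x'. \<sigma> x' \<in> prob_simplex) \<and> ?B < ?R \<sigma>"
    then obtain \<sigma> where \<sigma>: "\<forall>x'. \<sigma> x' \<in> prob_simplex" "?B < ?R \<sigma>" by blast
    then show False using R[OF \<sigma>(1)] D[OF \<sigma>(1)] by linarith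
  qed (use S in blast)
qed

text \<open>Maximizers need not be unique, as at next states of transition probability zero, but
  they share one value. This removes the existential quantifier from
  \<open>regularized_Q\<close>.\<close>

lemma is_arg_max_value_iff:
  fixes f :: "'b \<Rightarrow> 'c::linorder"
  assumes "is_arg_max f P s"
  shows "(\<exists>t. is_arg_max f P t \<and> v = f t) \<longleftrightarrow> v = f s"
proof
  assume "\<exists>t. is_arg_max f P t \<and> v = f t"
  then show "v = f s"
    using assms unfolding is_arg_max_def by (metis linorder_neqE)
qed (use assms in blast)

lemma regularized_Q_iff:
  assumes p: "p \<in> kernels N" and \<pi>: "\<forall>n\<in>{1..N}. \<forall>x a. 0 < \<pi> n x $ a" and \<tau>: "\<tau> > 0"
  shows "regularized_Q N p g \<tau> \<pi> \<mu> Q \<longleftrightarrow>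
    (\<forall>x a. Q N x a = - (g N (\<mu> N) $ (x, a))) \<and>
    (\<forall>n\<in>{1..<N}. \<forall>x a. Q n x a = soft_backup p (\<lambda>n. g n (\<mu> n)) \<tau> \<pi> n (Q (n + 1)) x a)"
proof -
  have "(\<exists>\<sigma>. is_arg_max (regularized_backup p g \<tau> \<pi> \<mu> Q n x a) (\<lambda>\<sigma>. \<forall>x'. \<sigma> x' \<in> prob_simplex) \<sigma> \<and>
          Q n x a = regularized_backup p g \<tau> \<pi> \<mu> Q n x a \<sigma>) \<longleftrightarrow>
        Q n x a = soft_backup p (\<lambda>n. g n (\<mu> n)) \<tau> \<pi> n (Q (n + 1)) x a"
    (is "(\<exists>\<sigma>. is_arg_max ?R ?P \<sigma> \<and> ?q = ?R \<sigma>) \<longleftrightarrow> ?q = ?B")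
    if n: "n \<in> {1..<N}" for n x a
  proof -
    have p': "0 \<le> p (n + 1) (x, a) $ x'" for x'
      using n p by (auto simp: kernels_def prob_simplex_def)
    have w: "0 < \<pi> (n + 1) x' $ a'" for x' a'
      using n \<pi> by simp
    note S = regularized_backup_softmax[where p = p and n = n and \<pi> = \<pi>, OF p' w \<tau>]
    show ?thesis
      unfolding S(2)[symmetric] by (rule is_arg_max_value_iff[OF S(1)])
  qed
  then show ?thesis
    unfolding regularized_Q_def by (intro conj_cong refl ball_cong arg_cong[where f = All] ext)
qed

lemma regularized_Q_exists:
  assumes "p \<in> kernels N" "\<forall>n\<in>{1..N}. \<forall>x a. 0 < \<pi> n x $ a" "\<tau> > 0"
  shows "\<exists>Q. regularized_Q N p g \<tau> \<pi> \<mu> Q"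
proof
  \<comment> \<open>\<open>soft_Q_back\<close> counts remaining steps, so time \<open>n\<close>
    corresponds to index \<open>N - n\<close>.\<close>
  let ?Q = "\<lambda>n. soft_Q_back N p (\<lambda>n. g n (\<mu> n)) \<tau> \<pi> (N - n)"
  have "?Q n = soft_backup p (\<lambda>n. g n (\<mu> n)) \<tau> \<pi> n (?Q (n + 1))" if "n \<in> {1..<N}" for n
  proof -
    have "N - n = Suc (N - (n + 1))" "N - Suc (N - (n + 1)) = n" using that by auto
    then show ?thesis by (simp only: soft_Q_back.simps)
  qed
  then show "regularized_Q N p g \<tau> \<pi> \<mu> ?Q"
    unfolding regularized_Q_iff[OF assms] by auto
qed

section \<open>Feasible sequences\<close>

abbreviation marginal :: "real ^ ('x::finite \<times> 'a::finite) \<Rightarrow> 'x \<Rightarrow> real" where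
  "marginal m x \<equiv> \<Sum>a\<in>UNIV. m $ (x, a)"

lemma sum_pairs:
  fixes h :: "'x::finite \<times> 'a::finite \<Rightarrow> real"
  shows "(\<Sum>i\<in>UNIV. h i) = (\<Sum>x\<in>UNIV. \<Sum>a\<in>UNIV. h (x, a))"
  by (simp add: sum.cartesian_product)

definition next_marginal ::
  "('x::finite, 'a::finite) kernel \<Rightarrow> nat \<Rightarrow> real ^ ('x \<times> 'a) \<Rightarrow> 'x \<Rightarrow> real" where
  "next_marginal p n m x' = (\<Sum>x\<in>UNIV. \<Sum>a\<in>UNIV. p n (x, a) $ x' * m $ (x, a))"

lemma next_marginal_eq: "next_marginal p n m x' = (\<Sum>i\<in>UNIV. p n i $ x' * m $ i)"
  by (simp add: next_marginal_def sum_pairs)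

lemma state_action_dist_Suc:
  "state_action_dist \<mu>0 p \<pi> (Suc n) $ (x, a) =
     next_marginal p (Suc n) (state_action_dist \<mu>0 p \<pi> n) x * \<pi> (Suc n) x $ a"
  by (simp add: next_marginal_def sum_distrib_left sum_distrib_right mult_ac)

declare state_action_dist.simps(2) [simp del]

text \<open>Indexing by the predecessor removes the subtraction \<open>n - 1\<close> and prepares
  inductions that start at the initial distribution.\<close>

lemma feasible_seqs_iff:
  "\<mu> \<in> feasible_seqs N \<mu>0 p \<longleftrightarrow>
    \<mu> \<in> {1..N} \<rightarrow>\<^sub>E prob_simplex \<and>
    (\<forall>n<N. \<forall>x. marginal (\<mu> (Suc n)) x = next_marginal p (Suc n) ((\<mu>(0 := \<mu>0)) n) x)"
proof -
  have "(\<forall>n\<in>{1..N}. \<phi> n) \<longleftrightarrow> (\<forall>n<N. \<phi> (Suc n))" for \<phi> :: "nat \<Rightarrow> bool"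
    by (metis Suc_le_eq atLeastAtMost_iff not0_implies_Suc not_one_le_zero le_add1 plus_1_eq_Suc)
  then show ?thesis unfolding feasible_seqs_def next_marginal_def by simp
qed

lemma feasible_seqs_nonneg:
  assumes "\<mu> \<in> feasible_seqs N \<mu>0 p" "n \<in> {1..N}"
  shows "0 \<le> \<mu> n $ i"
  using assms PiE_mem[of \<mu> "{1..N}" "\<lambda>_. prob_simplex" n]
  unfolding feasible_seqs_iff prob_simplex_def by blast

lemma next_marginal_sum:
  assumes "\<And>xa. p n xa \<in> prob_simplex" "m \<in> prob_simplex"
  shows "(\<Sum>x\<in>UNIV. next_marginal p n m x) = 1"
proof -
  have "(\<Sum>x'\<in>UNIV. next_marginal p n m x') =
      (\<Sum>i\<in>UNIV. \<Sum>x'\<in>UNIV. p n i $ x' * m $ i)"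
    unfolding next_marginal_eq by (rule sum.swap)
  also have "\<dots> = 1"
    using assms by (simp add: prob_simplex_def flip: sum_distrib_right)
  finally show ?thesis .
qed

lemma next_marginal_nonneg:
  assumes "\<And>xa. p n xa \<in> prob_simplex" "\<And>i. 0 \<le> m $ i"
  shows "0 \<le> next_marginal p n m x"
  using assms unfolding next_marginal_eq
  by (intro sum_nonneg mult_nonneg_nonneg) (auto simp: prob_simplex_def)

section \<open>Sequences induced by policies\<close>

lemma marginal_state_action_dist:
  assumes "\<pi> (Suc n) x \<in> prob_simplex"
  shows "marginal (state_action_dist \<mu>0 p \<pi> (Suc n)) x =
    next_marginal p (Suc n) (state_action_dist \<mu>0 p \<pi> n) x"
  using assms by (simp add: state_action_dist_Suc prob_simplex_def flip: sum_distrib_left)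

lemma state_action_dist_in_prob_simplex:
  assumes p: "p \<in> kernels N" and \<mu>0: "\<mu>0 \<in> prob_simplex" and \<pi>: "\<pi> \<in> policies N"
  shows "n \<le> N \<Longrightarrow> state_action_dist \<mu>0 p \<pi> n \<in> prob_simplex"
proof (induction n)
  case 0
  then show ?case using \<mu>0 by simp
next
  case (Suc n)
  let ?m = "state_action_dist \<mu>0 p \<pi>"
  have IH: "?m n \<in> prob_simplex" using Suc by simp
  have p': "p (Suc n) xa \<in> prob_simplex" for xa
    using p Suc.prems by (cases xa) (simp add: kernels_def)
  have \<pi>': "\<pi> (Suc n) x \<in> prob_simplex" for x
    using \<pi> Suc.prems by (auto simp: policies_def)
  have "0 \<le> ?m (Suc n) $ (x, a)" for x a
    using IH p' \<pi>' unfolding state_action_dist_Suc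
    by (intro mult_nonneg_nonneg next_marginal_nonneg) (auto simp: prob_simplex_def)
  moreover have "(\<Sum>i\<in>UNIV. ?m (Suc n) $ i) = 1"
    by (simp add: sum_pairs marginal_state_action_dist \<pi>' next_marginal_sum p' IH)
  ultimately show ?case by (auto simp: prob_simplex_def)
qed

lemma induced_seq_Suc:
  "n < N \<Longrightarrow> induced_seq N \<mu>0 p \<pi> (Suc n) = state_action_dist \<mu>0 p \<pi> (Suc n)"
  by (simp add: induced_seq_def)

lemma induced_seq_initial:
  "n \<le> N \<Longrightarrow> ((induced_seq N \<mu>0 p \<pi>)(0 := \<mu>0)) n = state_action_dist \<mu>0 p \<pi> n"
  by (cases n) (auto simp: induced_seq_def)

lemma induced_seq_feasible:
  assumes "p \<in> kernels N" "\<mu>0 \<in> prob_simplex" "\<pi> \<in> policies N"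
  shows "induced_seq N \<mu>0 p \<pi> \<in> feasible_seqs N \<mu>0 p"
proof -
  have "induced_seq N \<mu>0 p \<pi> \<in> {1..N} \<rightarrow>\<^sub>E prob_simplex"
    using state_action_dist_in_prob_simplex[OF assms] by (simp add: induced_seq_def)
  moreover have "\<pi> (Suc n) x \<in> prob_simplex" if "n < N" for n x
    using assms(3) that by (auto simp: policies_def)
  ultimately show ?thesis
    by (simp add: feasible_seqs_iff induced_seq_Suc induced_seq_initial marginal_state_action_dist
        del: fun_upd_apply)
qed

text \<open>The flow constraint forces each marginal from the preceding distribution, so a feasible
  sequence is determined by its conditional policies. The product form leaves \<open>\<pi>\<close>
  unconstrained where the marginal vanishes, as the equality case of the minimization
  requires.\<close>

lemma eq_induced_seq_iff:
  assumes \<mu>: "\<mu> \<in> feasible_seqs N \<mu>0 p" and \<pi>: "\<pi> \<in> policies N"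
  shows "\<mu> = induced_seq N \<mu>0 p \<pi> \<longleftrightarrow>
    (\<forall>n\<in>{1..N}. \<forall>x a. \<mu> n $ (x, a) = marginal (\<mu> n) x * \<pi> n x $ a)" (is "_ \<longleftrightarrow> ?R")
proof
  assume eq: "\<mu> = induced_seq N \<mu>0 p \<pi>"
  show ?R
  proof (intro ballI allI)
    fix n x a assume n: "n \<in> {1..N}"
    then obtain m where m: "n = Suc m" by (cases n) auto
    have "\<pi> n x \<in> prob_simplex" using \<pi> n by (auto simp: policies_def)
    then show "\<mu> n $ (x, a) = marginal (\<mu> n) x * \<pi> n x $ a"
      using n m by (simp add: eq induced_seq_Suc marginal_state_action_dist)
        (simp add: state_action_dist_Suc)
  qed
next
  assume R: ?R
  \<comment> \<open>The induction runs on the sequence extended by \<open>\<mu>0\<close>, which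
    drives the first step.\<close>
  have eq: "(\<mu>(0 := \<mu>0)) n = state_action_dist \<mu>0 p \<pi> n" if "n \<le> N" for n
    using that
  proof (induction n)
    case (Suc n)
    then have "marginal (\<mu> (Suc n)) x = next_marginal p (Suc n) (state_action_dist \<mu>0 p \<pi> n) x" for x
      using \<mu> by (simp add: feasible_seqs_iff del: fun_upd_apply)
    then have "\<mu> (Suc n) $ (x, a) = state_action_dist \<mu>0 p \<pi> (Suc n) $ (x, a)" for x a
      using R Suc.prems by (simp add: state_action_dist_Suc)
    then show ?case by (simp add: vec_eq_iff)
  qed simp
  have "\<mu> n = state_action_dist \<mu>0 p \<pi> n" if "n \<in> {1..N}" for n
    using eq[of n] that by simp
  \<comment> \<open>Agreement on \<open>{1..N}\<close> gives equality of functions because both are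
    \<open>undefined\<close> elsewhere.\<close>
  moreover have "\<mu> \<in> extensional {1..N}"
    using \<mu> by (simp add: feasible_seqs_iff PiE_iff)
  ultimately show "\<mu> = induced_seq N \<mu>0 p \<pi>"
    unfolding induced_seq_def by (intro extensionalityI[of _ "{1..N}"]) auto
qed

text \<open>Under a full-support policy a pair has mass zero only if its state receives no inflow:
  each predecessor has mass zero or transition probability zero. Zero mass of predecessors carries
  over to \<open>\<mu>\<close> by induction, so \<open>\<mu>\<close> has no inflow there
  either.\<close>

lemma feasible_seqs_absolutely_continuous:
  assumes \<mu>: "\<mu> \<in> feasible_seqs N \<mu>0 p" and \<mu>0: "\<mu>0 \<in> prob_simplex" and p: "p \<in> kernels N"
    and \<pi>: "\<pi> \<in> policies N" and pos: "\<forall>n\<in>{1..N}. \<forall>x a. \<pi> n x $ a \<noteq> 0"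
  shows "n \<le> N \<Longrightarrow> state_action_dist \<mu>0 p \<pi> n $ (x, a) = 0 \<Longrightarrow> (\<mu>(0 := \<mu>0)) n $ (x, a) = 0"
proof (induction n arbitrary: x a)
  case (Suc n)
  let ?m = "state_action_dist \<mu>0 p \<pi> n"
  have m: "0 \<le> ?m $ i" for i
    using state_action_dist_in_prob_simplex[OF p \<mu>0 \<pi>, of n] Suc.prems
    by (cases i) (simp add: prob_simplex_def)
  have p': "0 \<le> p (Suc n) i $ x" for i
    using p Suc.prems by (cases i) (simp add: kernels_def prob_simplex_def)
  have "next_marginal p (Suc n) ?m x = 0"
    using Suc.prems pos by (simp add: state_action_dist_Suc)
  then have "(\<Sum>i\<in>UNIV. p (Suc n) i $ x * ?m $ i) = 0"
    unfolding next_marginal_eq .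
  then have "p (Suc n) i $ x * ?m $ i = 0" for i
    by (rule sum_nonneg_0[rotated 2]) (simp_all add: m p')
  moreover have "?m $ i = 0 \<Longrightarrow> (\<mu>(0 := \<mu>0)) n $ i = 0" for i
    using Suc.IH[of "fst i" "snd i"] Suc.prems by simp
  ultimately have "p (Suc n) i $ x = 0 \<or> (\<mu>(0 := \<mu>0)) n $ i = 0" for i
    using mult_eq_0_iff by blast
  then have "p (Suc n) i $ x * (\<mu>(0 := \<mu>0)) n $ i = 0" for i
    unfolding mult_eq_0_iff .
  then have "next_marginal p (Suc n) ((\<mu>(0 := \<mu>0)) n) x = 0"
    unfolding next_marginal_eq by (intro sum.neutral ballI)
  then have "marginal (\<mu> (Suc n)) x = 0"
    using \<mu> Suc.prems(1) by (simp add: feasible_seqs_iff del: fun_upd_apply)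
  moreover have "0 \<le> \<mu> (Suc n) $ (x, b)" for b
    using Suc.prems(1) by (intro feasible_seqs_nonneg[OF \<mu>]) simp
  ultimately have "\<mu> (Suc n) $ (x, a) = 0"
    by (simp add: sum_nonneg_eq_0_iff)
  then show ?case by simp
qed simp

section \<open>Recovering policies from sequences\<close>

lemma policy_of_in_prob_simplex:
  assumes "\<And>a. 0 \<le> \<mu> n $ (x, a)"
  shows "policy_of \<mu> n x \<in> prob_simplex"
proof (cases "marginal (\<mu> n) x = 0")
  case False
  then show ?thesis
    using assms
    by (auto simp: prob_simplex_def policy_of_def sum_nonneg simp flip: sum_divide_distrib)
qed (simp add: prob_simplex_def policy_of_def)

text \<open>This survives marginal zero, where \<open>policy_of\<close> is uniform, because
  nonnegativity then forces all entries at \<open>x\<close> to vanish.\<close>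

lemma marginal_times_policy_of:
  assumes "\<And>a. 0 \<le> \<mu> n $ (x, a)"
  shows "marginal (\<mu> n) x * policy_of \<mu> n x $ a = \<mu> n $ (x, a)"
proof (cases "marginal (\<mu> n) x = 0")
  case True
  then have "\<mu> n $ (x, a) = 0"
    by (subst (asm) sum_nonneg_eq_0_iff) (use assms in auto)
  with True show ?thesis by simp
qed (simp add: policy_of_def)

lemma policy_of_induced_seq:
  assumes n: "n \<in> {1..N}" and p: "p \<in> kernels N" and \<mu>0: "\<mu>0 \<in> prob_simplex"
    and \<pi>: "\<pi> \<in> policies N" and nz: "induced_seq N \<mu>0 p \<pi> n $ (x, a) \<noteq> 0"
  shows "policy_of (induced_seq N \<mu>0 p \<pi>) n x = \<pi> n x"
proof -
  let ?\<mu> = "induced_seq N \<mu>0 p \<pi>"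
  define M where "M = marginal (?\<mu> n) x"
  have eq: "?\<mu> n $ (x, b) = M * \<pi> n x $ b" for b
    unfolding M_def using eq_induced_seq_iff[OF induced_seq_feasible[OF p \<mu>0 \<pi>] \<pi>] n by blast
  \<comment> \<open>A nonzero entry excludes the uniform default, and \<open>M\<close> then cancels
    in the quotient.\<close>
  with nz have "M \<noteq> 0" by auto
  then show ?thesis
    unfolding policy_of_def M_def[symmetric] by (simp add: eq vec_eq_iff)
qed

text \<open>
  At states unreachable under \<open>\<pi>\<close>, \<open>policy_of\<close> returns the uniform policy instead of \<open>\<pi>\<close>. As
  \<open>\<pi>\<close> has full support, every feasible sequence vanishes there.
\<close>

lemma Gamma_div_induced_seq:
  assumes \<mu>: "\<mu> \<in> feasible_seqs N \<mu>0 p" and \<mu>0: "\<mu>0 \<in> prob_simplex" and p: "p \<in> kernels N"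
    and \<pi>: "\<pi> \<in> policies N" and pos: "\<forall>n\<in>{1..N}. \<forall>x a. \<pi> n x $ a \<noteq> 0"
  shows "Gamma_div N \<mu> (induced_seq N \<mu>0 p \<pi>) =
    (\<Sum>n = 1..N. \<Sum>x\<in>UNIV. \<Sum>a\<in>UNIV. \<mu> n $ (x, a) * ln (policy_of \<mu> n x $ a / \<pi> n x $ a))"
  unfolding Gamma_div_def
proof (intro sum.cong refl)
  fix n x a assume n: "n \<in> {1..N}"
  let ?\<nu> = "induced_seq N \<mu>0 p \<pi>"
  show "\<mu> n $ (x, a) * ln (policy_of \<mu> n x $ a / policy_of ?\<nu> n x $ a) =
      \<mu> n $ (x, a) * ln (policy_of \<mu> n x $ a / \<pi> n x $ a)"
  proof (cases "\<mu> n $ (x, a) = 0")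
    case False
    then have "?\<nu> n $ (x, a) \<noteq> 0"
      using feasible_seqs_absolutely_continuous[OF \<mu> \<mu>0 p \<pi> pos, of n x a] n
      by (auto simp: induced_seq_def)
    then show ?thesis using policy_of_induced_seq[OF n p \<mu>0 \<pi>] by simp
  qed simp
qed

section \<open>The objective\<close>

text \<open>Exchanging sums shifts the transition from the soft values onto \<open>m\<close>,
  turning an expected continuation value into an expectation under the next state marginal.\<close>

lemma inner_soft_backup:
  fixes m :: "real ^ ('x::finite \<times> 'a::finite)"
  shows "(\<Sum>x\<in>UNIV. \<Sum>a\<in>UNIV. m $ (x, a) * soft_backup p c \<tau> \<pi> n q x a) =
    - (c n \<bullet> m) + (\<Sum>x\<in>UNIV. next_marginal p (n + 1) m x * soft_value \<tau> (\<pi> (n + 1) x) (q x))"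
proof -
  let ?V = "\<lambda>x'. soft_value \<tau> (\<pi> (n + 1) x') (q x')"
  have "(\<Sum>x\<in>UNIV. \<Sum>a\<in>UNIV. m $ (x, a) * soft_backup p c \<tau> \<pi> n q x a) =
      (\<Sum>i\<in>UNIV. m $ i * (- (c n $ i) + (\<Sum>x'\<in>UNIV. p (n + 1) i $ x' * ?V x')))"
    by (simp add: sum_pairs soft_backup_def)
  also have "\<dots> = - (c n \<bullet> m) + (\<Sum>i\<in>UNIV. \<Sum>x'\<in>UNIV. p (n + 1) i $ x' * m $ i * ?V x')"
    by (simp add: inner_vec_def sum_subtractf sum_distrib_left algebra_simps)
  also have "(\<Sum>i\<in>UNIV. \<Sum>x'\<in>UNIV. p (n + 1) i $ x' * m $ i * ?V x') =
      (\<Sum>x\<in>UNIV. next_marginal p (n + 1) m x * ?V x)"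
    by (subst sum.swap) (simp add: next_marginal_eq sum_distrib_right)
  finally show ?thesis .
qed

text \<open>Splitting \<open>\<mu> n\<close> into marginal and conditional policy allows the change
  of reference from \<open>\<pi>\<close> to the softmax policy at each state. In the objective the
  \<open>Q\<close> terms absorb the gradients and the soft values telescope.\<close>

lemma entropy_sum_softmax:
  assumes \<mu>: "\<And>x a. 0 \<le> \<mu> n $ (x, a)" and w: "\<And>x a. 0 < \<pi> n x $ a" and \<tau>: "\<tau> > 0"
  shows "1 / \<tau> * (\<Sum>x\<in>UNIV. \<Sum>a\<in>UNIV. \<mu> n $ (x, a) * ln (policy_of \<mu> n x $ a / \<pi> n x $ a)) =
    1 / \<tau> * (\<Sum>x\<in>UNIV. marginal (\<mu> n) x * rel_entropy (policy_of \<mu> n x) (softmax_policy \<tau> \<pi> Q n x))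
    + (\<Sum>x\<in>UNIV. \<Sum>a\<in>UNIV. \<mu> n $ (x, a) * Q n x a)
    - (\<Sum>x\<in>UNIV. marginal (\<mu> n) x * soft_value \<tau> (\<pi> n x) (Q n x))"
proof -
  let ?s = "policy_of \<mu> n" and ?t = "softmax_policy \<tau> \<pi> Q n"
  let ?V = "\<lambda>x. soft_value \<tau> (\<pi> n x) (Q n x)"
  have s: "0 \<le> ?s x $ a" for x a
    using policy_of_in_prob_simplex[of \<mu> n x, OF \<mu>] by (simp add: prob_simplex_def)
  have eq: "1 / \<tau> * (\<mu> n $ (x, a) * ln (?s x $ a / \<pi> n x $ a)) =
      1 / \<tau> * (marginal (\<mu> n) x * (?s x $ a * ln (?s x $ a / ?t x $ a)))
      + \<mu> n $ (x, a) * Q n x a - \<mu> n $ (x, a) * ?V x" for x a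
    using entropy_term_softmax[of "\<pi> n x" \<tau> "?s x $ a" "marginal (\<mu> n) x" a "Q n x", OF w \<tau> s]
    unfolding marginal_times_policy_of[of \<mu> n x, OF \<mu>] softmax_policy_eq mult.assoc[symmetric]
    by (simp add: algebra_simps)
  show ?thesis
    unfolding sum_distrib_left eq
    by (simp add: sum.distrib sum_subtractf rel_entropy_def sum_distrib_left sum_distrib_right)
qed

lemma step_objective_decomposition:
  assumes N: "N \<ge> 1" and p: "p \<in> kernels N" and \<mu>0: "\<mu>0 \<in> prob_simplex"
    and \<pi>: "\<pi> \<in> policies N" and pos: "\<forall>n\<in>{1..N}. \<forall>x a. 0 < \<pi> n x $ a" and \<tau>: "\<tau> > 0"
    and \<nu>: "\<nu> = induced_seq N \<mu>0 p \<pi>" and Q: "regularized_Q N p g \<tau> \<pi> \<nu> Q"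
    and \<mu>: "\<mu> \<in> feasible_seqs N \<mu>0 p"
  shows "step_objective N g \<tau> \<nu> \<mu> =
    - (\<Sum>x\<in>UNIV. next_marginal p 1 \<mu>0 x * soft_value \<tau> (\<pi> 1 x) (Q 1 x))
    + 1 / \<tau> * (\<Sum>n = 1..N. \<Sum>x\<in>UNIV.
        marginal (\<mu> n) x * rel_entropy (policy_of \<mu> n x) (softmax_policy \<tau> \<pi> Q n x))"
proof -
  let ?c = "\<lambda>n. g n (\<nu> n)"
  let ?D = "\<lambda>n. \<Sum>x\<in>UNIV. marginal (\<mu> n) x * rel_entropy (policy_of \<mu> n x) (softmax_policy \<tau> \<pi> Q n x)"
  \<comment> \<open>Expected soft value at step \<open>n\<close>. The cutoff beyond \<open>N\<close>
    lets the terminal condition, which has no continuation, share the formula of the other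
    steps.\<close>
  define U where
    "U n = (if n \<le> N then \<Sum>x\<in>UNIV. marginal (\<mu> n) x * soft_value \<tau> (\<pi> n x) (Q n x) else 0)" for n
  have QU: "(\<Sum>x\<in>UNIV. \<Sum>a\<in>UNIV. \<mu> n $ (x, a) * Q n x a) = - (?c n \<bullet> \<mu> n) + U (Suc n)"
    if n: "n \<in> {1..N}" for n
  proof (cases "n = N")
    case True
    then have "Q n x a = - (?c n $ (x, a))" for x a
      using Q by (simp add: regularized_Q_def)
    then show ?thesis
      using True by (simp add: U_def inner_vec_def sum_pairs sum_negf mult.commute)
  next
    case False
    then have "n \<in> {1..<N}" using n by auto
    then have "Q n x a = soft_backup p ?c \<tau> \<pi> n (Q (n + 1)) x a" for x a
      using Q unfolding regularized_Q_iff[OF p pos \<tau>] by blast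
    \<comment> \<open>The flow constraint identifies the expected continuation value with
      \<open>U (Suc n)\<close>.\<close>
    moreover have "next_marginal p (n + 1) (\<mu> n) x = marginal (\<mu> (Suc n)) x" for x
      using \<mu> n False by (auto simp: feasible_seqs_iff)
    ultimately show ?thesis
      using n False by (simp add: inner_soft_backup U_def)
  qed
  have pos': "0 < \<pi> n x $ a" if "n \<in> {1..N}" for n x a
    using pos that by simp
  \<comment> \<open>Combining \<open>QU\<close> with the entropy identity cancels the
    \<open>Q\<close> terms and leaves a difference of consecutive \<open>U\<close>.\<close>
  have step: "?c n \<bullet> \<mu> n + 1 / \<tau> *
      (\<Sum>x\<in>UNIV. \<Sum>a\<in>UNIV. \<mu> n $ (x, a) * ln (policy_of \<mu> n x $ a / \<pi> n x $ a)) =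
      1 / \<tau> * ?D n + (U (Suc n) - U n)" if n: "n \<in> {1..N}" for n
    using n QU[OF n] entropy_sum_softmax[of \<mu> n \<pi> \<tau> Q, OF feasible_seqs_nonneg[OF \<mu> n] pos'[OF n] \<tau>]
    by (simp add: U_def)
  have nz: "\<forall>n\<in>{1..N}. \<forall>x a. \<pi> n x $ a \<noteq> 0"
    using pos by (metis less_irrefl)
  have "step_objective N g \<tau> \<nu> \<mu> = (\<Sum>n = 1..N. ?c n \<bullet> \<mu> n + 1 / \<tau> *
      (\<Sum>x\<in>UNIV. \<Sum>a\<in>UNIV. \<mu> n $ (x, a) * ln (policy_of \<mu> n x $ a / \<pi> n x $ a)))"
    unfolding step_objective_def \<nu> Gamma_div_induced_seq[OF \<mu> \<mu>0 p \<pi> nz]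
    by (simp add: sum.distrib sum_distrib_left)
  also have "\<dots> = (\<Sum>n = 1..N. 1 / \<tau> * ?D n) + (\<Sum>n = 1..N. U (Suc n) - U n)"
    unfolding sum.distrib[symmetric] by (intro sum.cong refl step)
  also have "(\<Sum>n = 1..N. U (Suc n) - U n) = - U 1"
    using sum_Suc_diff[of 1 N U] by (simp add: U_def)
  \<comment> \<open>The first marginals are fixed by \<open>\<mu>0\<close>, so this constant is
    common to all feasible sequences.\<close>
  also have "U 1 = (\<Sum>x\<in>UNIV. next_marginal p 1 \<mu>0 x * soft_value \<tau> (\<pi> 1 x) (Q 1 x))"
    using \<mu> N unfolding U_def by (force simp: feasible_seqs_iff)
  finally show ?thesis by (simp add: sum_distrib_left)
qed

section \<open>Existence of the recursion's solution and uniqueness of the minimizer\<close>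

theorem theorem4p1:
  fixes N :: nat
    and p :: "('x::finite, 'a::finite) kernel"
    and \<mu>0 :: "real ^ ('x \<times> 'a)"
    and f :: "nat \<Rightarrow> real ^ ('x \<times> 'a) \<Rightarrow> real"
    and g :: "nat \<Rightarrow> real ^ ('x \<times> 'a) \<Rightarrow> real ^ ('x \<times> 'a)"
    and l \<tau> :: real
    and \<pi>k :: "('x, 'a) policy"
    and \<mu>k :: "('x, 'a) dist_seq"
  assumes "N \<ge> 1"
    and "p \<in> kernels N"
    and "\<mu>0 \<in> prob_simplex"
    and "\<And>n. n \<in> {1..N} \<Longrightarrow> convex_on prob_simplex (f n)"
    and "\<And>n \<mu> \<nu>. n \<in> {1..N} \<Longrightarrow> \<mu> \<in> prob_simplex \<Longrightarrow> \<nu> \<in> prob_simplex \<Longrightarrow>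
           \<bar>f n \<mu> - f n \<nu>\<bar> \<le> l * norm_l1 (\<mu> - \<nu>)"
    and "\<And>n \<mu>. n \<in> {1..N} \<Longrightarrow> \<mu> \<in> prob_simplex \<Longrightarrow>
           (f n has_derivative (\<lambda>h. g n \<mu> \<bullet> h)) (at \<mu> within prob_simplex)"
    and "\<tau> > 0"
    and "\<pi>k \<in> policies N"
    and "\<And>n x a. n \<in> {1..N} \<Longrightarrow> \<pi>k n x $ a \<noteq> 0"
    and "\<mu>k = induced_seq N \<mu>0 p \<pi>k"
    and "\<mu>k \<in> feasible_seqs_pos N \<mu>0 p"
  shows "(\<exists>Q. regularized_Q N p g \<tau> \<pi>k \<mu>k Q) \<and>
    (\<forall>Q. regularized_Q N p g \<tau> \<pi>k \<mu>k Q \<longrightarrow>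
      (\<forall>\<mu>. is_arg_min (step_objective N g \<tau> \<mu>k) (\<lambda>\<mu>. \<mu> \<in> feasible_seqs N \<mu>0 p) \<mu> \<longleftrightarrow>
           \<mu> = induced_seq N \<mu>0 p (softmax_policy \<tau> \<pi>k Q)))"
proof (intro conjI allI impI)
  have pos: "0 < \<pi>k n x $ a" if "n \<in> {1..N}" for n x a
    using assms(8) assms(9)[OF that] that
    by (auto simp: policies_def prob_simplex_def less_le)
  show "\<exists>Q. regularized_Q N p g \<tau> \<pi>k \<mu>k Q"
    by (rule regularized_Q_exists) (use assms(2,7) pos in auto)
  fix Q \<mu>
  assume Q: "regularized_Q N p g \<tau> \<pi>k \<mu>k Q"
  let ?S = "softmax_policy \<tau> \<pi>k Q"
  let ?J = "step_objective N g \<tau> \<mu>k"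
  let ?F = "\<lambda>\<mu>. \<mu> \<in> feasible_seqs N \<mu>0 p"
  let ?opt = "induced_seq N \<mu>0 p ?S"
  \<comment> \<open>Up to the factor \<open>1 / \<tau>\<close>, the excess cost of
    \<open>\<mu>\<close> over the optimum incurred at step \<open>n\<close> in state
    \<open>x\<close>.\<close>
  define d where "d \<mu> n x = marginal (\<mu> n) x * rel_entropy (policy_of \<mu> n x) (?S n x)"
    for \<mu> :: "('x, 'a) dist_seq" and n x
  define C where "C = - (\<Sum>x\<in>UNIV. next_marginal p 1 \<mu>0 x * soft_value \<tau> (\<pi>k 1 x) (Q 1 x))"
  have S: "?S n x \<in> prob_simplex" "0 < ?S n x $ a" if "n \<in> {1..N}" for n x a
    unfolding softmax_policy_eq using pos[OF that]
    by (auto intro: softmax_in_prob_simplex softmax_pos)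
  have S_pol: "?S \<in> policies N"
    using S by (simp add: policies_def)
  have J: "?J \<mu> = C + 1 / \<tau> * (\<Sum>n = 1..N. \<Sum>x\<in>UNIV. d \<mu> n x)" if "?F \<mu>" for \<mu>
    unfolding C_def d_def
    by (rule step_objective_decomposition) (use assms pos Q that in auto)
  have d_nonneg: "0 \<le> d \<mu> n x" and
    d_eq_0: "d \<mu> n x = 0 \<longleftrightarrow> (\<forall>a. \<mu> n $ (x, a) = marginal (\<mu> n) x * ?S n x $ a)"
    if \<mu>: "?F \<mu>" and n: "n \<in> {1..N}" for \<mu> n x
  proof -
    note nonneg = feasible_seqs_nonneg[OF \<mu> n]
    have s: "policy_of \<mu> n x \<in> prob_simplex"
      by (rule policy_of_in_prob_simplex) (rule nonneg)
    show "0 \<le> d \<mu> n x"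
      unfolding d_def using nonneg S[OF n] s
      by (intro mult_nonneg_nonneg sum_nonneg rel_entropy_nonneg)
    have "d \<mu> n x = 0 \<longleftrightarrow> marginal (\<mu> n) x = 0 \<or> policy_of \<mu> n x = ?S n x"
      unfolding d_def using rel_entropy_eq_0_iff[OF s S(1)[OF n] S(2)[OF n]] by simp
    \<comment> \<open>Multiplying by the marginal merges the two alternatives into one equation, the
      criterion of \<open>eq_induced_seq_iff\<close>.\<close>
    also have "\<dots> \<longleftrightarrow> (\<forall>a. marginal (\<mu> n) x * policy_of \<mu> n x $ a = marginal (\<mu> n) x * ?S n x $ a)"
      by (auto simp: vec_eq_iff)
    finally show "d \<mu> n x = 0 \<longleftrightarrow> (\<forall>a. \<mu> n $ (x, a) = marginal (\<mu> n) x * ?S n x $ a)"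
      unfolding marginal_times_policy_of[of \<mu> n x, OF nonneg] .
  qed
  have J_ge: "C \<le> ?J \<mu>" if "?F \<mu>" for \<mu>
  proof -
    have "0 \<le> (\<Sum>n = 1..N. \<Sum>x\<in>UNIV. d \<mu> n x)"
      by (intro sum_nonneg d_nonneg[OF that])
    then show ?thesis unfolding J[OF that] using assms(7) by simp
  qed
  have J_eq: "?J \<mu> = C \<longleftrightarrow> \<mu> = ?opt" if "?F \<mu>" for \<mu>
  proof -
    have "?J \<mu> = C \<longleftrightarrow> (\<Sum>n = 1..N. \<Sum>x\<in>UNIV. d \<mu> n x) = 0"
      unfolding J[OF that] using assms(7) by simp
    also have "\<dots> \<longleftrightarrow> (\<forall>n\<in>{1..N}. \<forall>x. d \<mu> n x = 0)"
    proof -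
      have "(\<Sum>n = 1..N. \<Sum>x\<in>UNIV. d \<mu> n x) = 0 \<longleftrightarrow> (\<forall>n\<in>{1..N}. (\<Sum>x\<in>UNIV. d \<mu> n x) = 0)"
        by (intro sum_nonneg_eq_0_iff finite_atLeastAtMost sum_nonneg d_nonneg[OF that])
      also have "\<dots> \<longleftrightarrow> (\<forall>n\<in>{1..N}. \<forall>x\<in>UNIV. d \<mu> n x = 0)"
        by (intro ball_cong refl sum_nonneg_eq_0_iff finite_class.finite_UNIV d_nonneg[OF that])
      finally show ?thesis by simp
    qed
    also have "\<dots> \<longleftrightarrow> \<mu> = ?opt"
      unfolding eq_induced_seq_iff[OF that S_pol] using d_eq_0[OF that] by simp
    finally show ?thesis .
  qed
  \<comment> \<open>Feasibility of \<open>?opt\<close> shows that the lower bound \<open>C\<close>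
    is attained, so every minimizer has value \<open>C\<close> and hence equals
    \<open>?opt\<close>.\<close>
  have "?F ?opt"
    by (rule induced_seq_feasible[OF assms(2,3) S_pol])
  then show "is_arg_min ?J ?F \<mu> \<longleftrightarrow> \<mu> = ?opt"
    unfolding is_arg_min_def using J_ge J_eq by (metis less_le not_less)
qed

end
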